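(* Let $f(x)=\frac{\Gamma(x)^2}{2\Gamma(2x)}$ for $x>0$ and, for integers $r\ge0$, let $$T_r\left(\frac\pi4\right)=\sum_{k=1}^{\infty}2^{k-1}(D+\log2)^r f(k).$$ Then $$T_0\left(\frac\pi4\right)=\frac\pi4,\qquad T_1\left(\frac\pi4\right)=-G,$$ $$T_2\left(\frac\pi4\right)=-\frac{\pi^3}{12}-2\operatorname{Ls}_3\left(\frac\pi2\right),$$ $$T_3\left(\frac\pi4\right)=3\pi\zeta(3)+\pi^2G-4\operatorname{Ls}_4\left(\frac\pi2\right).$$ In particular, $$\sum_{k=1}^{\infty}2^{k-1}f'(k)=-G-\frac\pi4\log2.$$
   Context: $D$ denotes differentiation with respect to the argument of $f$, so $(D+\log2)^r f(k)=\sum_{j=0}^r\binom{r}{j}(\log2)^{r-j}f^{(j)}(k)$. $G=\sum_{n=0}^\infty\frac{(-1)^n}{(2n+1)^2}$ is Catalan's constant and $\zeta$ is the Riemann zeta function. For $n\ge2$ and $0\le\phi\le2\pi$, $\operatorname{Ls}_n(\phi)=-\int_0^\phi\log^{n-1}\left(2\sin\frac{x}{2}\right)dx$. *)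

theory Defs
  imports "HOL-Analysis.Analysis"
begin

definition half_central_beta :: "real \<Rightarrow> real" where
  "half_central_beta x = Gamma x ^ 2 / (2 * Gamma (2 * x))"

text \<open>The operator \<open>(D + log 2)^r\<close>, expanded binomially; \<open>(deriv ^^ j) f\<close> is the
  \<open>j\<close>-th derivative of \<open>f\<close>.\<close>

definition D_plus_log2_pow :: "nat \<Rightarrow> (real \<Rightarrow> real) \<Rightarrow> real \<Rightarrow> real" where
  "D_plus_log2_pow r f x =
     (\<Sum>j=0..r. real (r choose j) * ln 2 ^ (r - j) * (deriv ^^ j) f x)"

text \<open>Series over \<open>k \<ge> 1\<close> are indexed by \<open>n = k - 1\<close>, so that \<open>2 ^ (k - 1) = 2 ^ n\<close>.\<close>

definition T_term :: "nat \<Rightarrow> nat \<Rightarrow> real" where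
  "T_term r n = 2 ^ n * D_plus_log2_pow r half_central_beta (real (n + 1))"

definition T_pi4 :: "nat \<Rightarrow> real" where
  "T_pi4 r = (\<Sum>n. T_term r n)"

definition catalan_const :: real where
  "catalan_const = (\<Sum>n. (-1) ^ n / (2 * real n + 1) ^ 2)"

text \<open>The Riemann zeta function on the real half-line \<open>s > 1\<close>, where it is given by its
  Dirichlet series; outside that range the value is meaningless.\<close>

definition real_zeta :: "real \<Rightarrow> real" where
  "real_zeta s = (\<Sum>n. 1 / real (n + 1) powr s)"

text \<open>The log-sine integrals, meaningful for \<open>n \<ge> 2\<close> and \<open>0 \<le> \<phi> \<le> 2 \<pi>\<close>. The integrand is
  (absolutely) integrable there; at the endpoints \<open>0\<close> and \<open>2 \<pi>\<close> it is singular, and the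
  convention \<open>ln 0 = 0\<close> affects only a null set.\<close>

definition Ls :: "nat \<Rightarrow> real \<Rightarrow> real" where
  "Ls n \<phi> = - integral {0..\<phi>} (\<lambda>x. ln (2 * sin (x / 2)) ^ (n - 1))"

end

theory Submission
  imports Defs "HOL-Complex_Analysis.Complex_Analysis" "HOL-Real_Asymp.Real_Asymp"
begin

text \<open>
  Since \<open>2^x (D + log 2)^r f = D^r (2^x f)\<close>, the series \<open>T_r\<close> is the \<open>r\<close>-th derivative at
  \<open>a = 0\<close> of \<open>S(a) = \<Sum>n. 2^(n+a) f(n+1+a)\<close>. The moments
  \<open>K(a) = \<integral> (2 sin x)^(2a) dx\<close> over \<open>[0, \<pi>/4]\<close> satisfy
  \<open>(4a + 2) K(a) - (a + 1) K(a + 1) = 2^a\<close>, so \<open>K(a) \<Gamma>(a + 1)^2 / \<Gamma>(2a + 1)\<close> telescopes and equals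
  \<open>S(a)\<close>. The Taylor coefficients of \<open>K\<close> at 0 are log-sine integrals, those of
  \<open>\<Gamma>(a + 1)^2 / \<Gamma>(2a + 1)\<close> are polygamma values at 1, and the Leibniz rule gives the claim.
\<close>

subsection \<open>Sine moments\<close>

definition log_sine_moment :: "nat \<Rightarrow> real" where
  "log_sine_moment n = integral {0..pi/4} (\<lambda>x. ln (2 * sin x) ^ n)"

text \<open>The exponential form expands directly in powers of \<open>ln (2 * sin x)\<close>. At
  \<open>x = 0\<close> the convention \<open>ln 0 = 0\<close> makes the integrand 1 instead of a
  limit, which affects only a null set.\<close>

definition sine_moment :: "real \<Rightarrow> real" where
  "sine_moment a = integral {0..pi/4} (\<lambda>x. exp (2 * a * ln (2 * sin x)))"

text \<open>By the mean value theorem \<open>sin x = x * cos z\<close> with \<open>cos z\<close> at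
  least \<open>cos (pi/4)\<close>, hence at least 1/2. So the singularity of
  \<open>ln (2 * sin x)\<close> at 0 is no worse than that of \<open>ln x\<close>.\<close>

lemma two_sin_bounds:
  assumes "x \<in> {0<..pi/4}"
  shows "x \<le> 2 * sin x" "2 * sin x \<le> 2" "sin x > 0"
proof -
  have x: "0 < x" "x \<le> pi/4" using assms by auto
  obtain z where z: "0 < z" "z < x" "sin x - sin 0 = (x - 0) * cos z"
    using MVT2[of 0 x sin cos] x by auto
  have "cos z \<ge> cos (pi/4)" using x z by (intro cos_monotone_0_pi_le) auto
  moreover have "1 \<le> sqrt (2::real)" by simp
  ultimately have "cos z \<ge> 1/2" unfolding cos_45 by linarith
  then have "x * (1/2) \<le> x * cos z" using x by (intro mult_left_mono) auto
  then show "x \<le> 2 * sin x" using z by simp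
  with x show "sin x > 0" by linarith
  show "2 * sin x \<le> 2" by simp
qed

section \<open>Integrability of log-sine powers and the power series of the sine moment\<close>

lemma ln_two_sin_measurable:
  "(\<lambda>x. ln (2 * sin x)) \<in> borel_measurable (lebesgue_on S)" for S :: "real set"
  by (intro measurable_restrict_space1 measurable_completion) simp

text \<open>Where \<open>2 * sin x < 1\<close> the function is
  \<open>(2 * sin x) powr (-1/2)\<close>, at most the integrable \<open>x powr (-1/2)\<close>;
  elsewhere it is at most 2. This one function dominates everything below: each log-sine power up to
  a constant, and the partial sums of the exponential series.\<close>

lemma integrable_exp_half_abs_ln_sin:
  "(\<lambda>x. exp (\<bar>ln (2 * sin x)\<bar> / 2)) integrable_on {0..pi/4}"
proof (rule measurable_bounded_by_integrable_imp_integrable)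
  show "(\<lambda>x. exp (\<bar>ln (2 * sin x)\<bar> / 2)) \<in> borel_measurable (lebesgue_on {0..pi/4})"
    using ln_two_sin_measurable by measurable
  have "(\<lambda>x. x powr (-1/2)) integrable_on {0..pi/4}"
    using has_integral_powr_from_0[of "-1/2" "pi/4"] by (auto simp: integrable_on_def)
  then show "(\<lambda>x. 2 + x powr (-1/2)) integrable_on {0..pi/4}"
    by (intro integrable_add) auto
  fix x :: real assume x: "x \<in> {0..pi/4}"
  show "norm (exp (\<bar>ln (2 * sin x)\<bar> / 2)) \<le> 2 + x powr (-1/2)"
  proof (cases "x = 0")
    case False
    define y where "y = 2 * sin x"
    have y: "x \<le> y" "y \<le> 2" "0 < y" "0 < x"
      using two_sin_bounds[of x] x False by (auto simp: y_def)
    show ?thesis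
    proof (cases "y \<ge> 1")
      case True
      have "exp (\<bar>ln y\<bar> / 2) \<le> exp (ln y)" using True by (subst exp_le_cancel_iff) simp
      also have "\<dots> \<le> 2" using y by simp
      finally show ?thesis by (simp add: y_def add_increasing2)
    next
      case False
      then have "exp (\<bar>ln y\<bar> / 2) = y powr (-1/2)" using y by (simp add: powr_def)
      also have "\<dots> \<le> x powr (-1/2)" using y by (intro powr_mono2') auto
      finally show ?thesis by (simp add: y_def)
    qed
  qed auto
qed auto

lemma power_div_fact_le_exp:
  fixes x :: real
  assumes "x \<ge> 0"
  shows "x ^ n / fact n \<le> exp x"
proof -
  have s: "(\<lambda>n. x ^ n / fact n) sums exp x"
    using exp_converges[of x] by (simp add: scaleR_conv_of_real field_simps)
  have "(\<Sum>i\<in>{n}. x ^ i / fact i) \<le> (\<Sum>i. x ^ i / fact i)"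
    using s assms by (intro sum_le_suminf) (auto simp: sums_iff)
  then show ?thesis using s by (simp add: sums_iff)
qed

text \<open>One term of the exponential series at \<open>|ln (2 * sin x)| / 2\<close>; the factor
  \<open>2 ^ n\<close> undoes the halving.\<close>

lemma abs_ln_sin_power_le:
  fixes x :: real
  shows "\<bar>ln (2 * sin x) ^ n\<bar> \<le> 2 ^ n * fact n * exp (\<bar>ln (2 * sin x)\<bar> / 2)"
  using power_div_fact_le_exp[of "\<bar>ln (2 * sin x)\<bar> / 2" n]
  by (simp add: power_abs power_divide field_simps)

lemma integrable_ln_sin_power:
  "(\<lambda>x. ln (2 * sin x) ^ n) integrable_on {0..pi/4}"
proof (rule measurable_bounded_by_integrable_imp_integrable)
  show "(\<lambda>x. ln (2 * sin x) ^ n) \<in> borel_measurable (lebesgue_on {0..pi/4})"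
    using ln_two_sin_measurable by measurable
  show "(\<lambda>x. 2 ^ n * fact n * exp (\<bar>ln (2 * sin x)\<bar> / 2)) integrable_on {0..pi/4}"
    by (intro integrable_on_mult_right integrable_exp_half_abs_ln_sin)
qed (use abs_ln_sin_power_le in auto)

text \<open>The growth \<open>2 ^ n * fact n\<close> is what gives the Taylor series of
  \<open>sine_moment\<close> a positive radius of convergence.\<close>

lemma abs_log_sine_moment_le:
  "\<bar>log_sine_moment n\<bar> \<le>
     2 ^ n * fact n * integral {0..pi/4} (\<lambda>x. exp (\<bar>ln (2 * sin x)\<bar> / 2))"
proof -
  have "norm (log_sine_moment n) \<le>
      integral {0..pi/4} (\<lambda>x. 2 ^ n * fact n * exp (\<bar>ln (2 * sin x)\<bar> / 2))"
    unfolding log_sine_moment_def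
    by (intro integral_norm_bound_integral integrable_ln_sin_power integrable_on_mult_right
        integrable_exp_half_abs_ln_sin) (use abs_ln_sin_power_le in auto)
  then show ?thesis by simp
qed

text \<open>The exponential series is integrated termwise by dominated convergence. For
  \<open>a\<close> up to 1/4 the exponent \<open>2 * a\<close> is at most 1/2, so
  \<open>exp (|ln (2 * sin x)| / 2)\<close> dominates all partial sums.\<close>

lemma sine_moment_sums:
  assumes "0 \<le> a" "a \<le> 1/4"
  shows "(\<lambda>n. (2 * a) ^ n * log_sine_moment n / fact n) sums sine_moment a"
proof -
  let ?f = "\<lambda>N x. \<Sum>n<N. (2 * a * ln (2 * sin x)) ^ n / fact n"
  have "(\<lambda>N. integral {0..pi/4} (?f N)) \<longlonglongrightarrow> sine_moment a"
    unfolding sine_moment_def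
  proof (rule dominated_convergence(2))
    show "?f N integrable_on {0..pi/4}" for N
      by (intro integrable_sum) (auto simp: power_mult_distrib
          intro!: integrable_on_divide integrable_on_mult_right integrable_ln_sin_power)
    show "(\<lambda>x. exp (\<bar>ln (2 * sin x)\<bar> / 2)) integrable_on {0..pi/4}"
      by (rule integrable_exp_half_abs_ln_sin)
    fix x :: real
    let ?y = "2 * a * ln (2 * sin x)"
    have s: "(\<lambda>n. y ^ n / fact n) sums exp y" for y :: real
      using exp_converges[of y] by (simp add: scaleR_conv_of_real field_simps)
    show "(\<lambda>N. ?f N x) \<longlonglongrightarrow> exp ?y" using s by (simp add: sums_def)
    fix N
    have "norm (?f N x) \<le> (\<Sum>n<N. \<bar>?y\<bar> ^ n / fact n)"
      by (rule order_trans[OF norm_sum]) (simp add: power_abs)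
    also have "\<dots> \<le> (\<Sum>n. \<bar>?y\<bar> ^ n / fact n)"
      using s[of "\<bar>?y\<bar>"] by (intro sum_le_suminf) (auto simp: sums_iff)
    also have "\<dots> = exp \<bar>?y\<bar>" using s by (simp add: sums_iff)
    also have "\<dots> \<le> exp (\<bar>ln (2 * sin x)\<bar> / 2)"
      using assms mult_right_mono[of "2 * a" "1/2" "\<bar>ln (2 * sin x)\<bar>"] by (simp add: abs_mult)
    finally show "norm (?f N x) \<le> exp (\<bar>ln (2 * sin x)\<bar> / 2)" .
  qed
  moreover have "integral {0..pi/4} (?f N) = (\<Sum>n<N. (2 * a) ^ n * log_sine_moment n / fact n)" for N
    unfolding log_sine_moment_def
    by (subst integral_sum)
      (auto simp: power_mult_distrib intro!: integrable_on_divide integrable_on_mult_right integrable_ln_sin_power)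
  ultimately show ?thesis by (simp add: sums_def)
qed

section \<open>Growth bound and recurrence for the sine moments\<close>

lemma ln_two_sin_le: 
  assumes "x \<in> {0..pi/4}"
  shows "ln (2 * sin x) \<le> ln 2"
proof (cases "x = 0")
  case False
  then show ?thesis using two_sin_bounds[of x] assms by auto
qed auto

lemma integrable_sine_moment:
  assumes "a \<ge> 0"
  shows "(\<lambda>x. exp (2 * a * ln (2 * sin x))) integrable_on {0..pi/4}"
proof (rule measurable_bounded_by_integrable_imp_integrable)
  show "(\<lambda>x. exp (2 * a * ln (2 * sin x))) \<in> borel_measurable (lebesgue_on {0..pi/4})"
    using ln_two_sin_measurable by measurable
  show "(\<lambda>x. exp (2 * a * ln 2)) integrable_on {0..pi/4}" by (rule integrable_const_ivl)
  show "norm (exp (2 * a * ln (2 * sin x))) \<le> exp (2 * a * ln 2)" if "x \<in> {0..pi/4}" for x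
    using ln_two_sin_le[OF that] assms by (simp add: mult_left_mono)
qed auto

lemma sine_moment_nonneg: "sine_moment a \<ge> 0"
  unfolding sine_moment_def by (cases "(\<lambda>x. exp (2 * a * ln (2 * sin x))) integrable_on {0..pi/4}")
    (auto intro!: integral_nonneg simp: not_integrable_integral)

lemma exp_ln_two_sin_plus1:
  assumes "x \<in> {0<..pi/4}"
  shows "exp (2 * (a + 1) * ln (2 * sin x)) = 4 * sin x ^ 2 * exp (2 * a * ln (2 * sin x))"
proof -
  have "exp (2 * (a + 1) * ln (2 * sin x)) = exp (2 * a * ln (2 * sin x)) * exp (ln (2 * sin x)) ^ 2"
    by (simp add: ring_distribs exp_add flip: exp_double)
  also have "exp (ln (2 * sin x)) = 2 * sin x" using two_sin_bounds[OF assms] by simp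
  finally show ?thesis by (simp add: power_mult_distrib)
qed

text \<open>Raising \<open>a\<close> by 1 multiplies the integrand by \<open>4 * sin x ^ 2\<close>,
  which is at most 2 up to \<open>pi/4\<close>. The bound later forces the remainder of the
  telescoping sum to 0.\<close>

lemma sine_moment_plus1_le:
  assumes "a \<ge> 0"
  shows "sine_moment (a + 1) \<le> 2 * sine_moment a"
proof -
  have "sine_moment (a + 1) \<le> integral {0..pi/4} (\<lambda>x. 2 * exp (2 * a * ln (2 * sin x)))"
    unfolding sine_moment_def
  proof (rule integral_le)
    fix x :: real assume x: "x \<in> {0..pi/4}"
    show "exp (2 * (a + 1) * ln (2 * sin x)) \<le> 2 * exp (2 * a * ln (2 * sin x))"
    proof (cases "x = 0")
      case False
      have "sin x \<le> sin (pi/4)" using x by (intro sin_monotone_2pi_le) auto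
      then have "(sin x)\<^sup>2 \<le> (sin (pi/4))\<^sup>2" using x two_sin_bounds[of x] False
        by (intro power_mono) auto
      then have "4 * (sin x)\<^sup>2 \<le> 2" by (simp add: sin_45 power_divide)
      then show ?thesis using x False by (subst exp_ln_two_sin_plus1) (auto intro!: mult_right_mono)
    qed auto
  qed (use assms in \<open>intro integrable_sine_moment integrable_on_mult_right; simp\<close>)+
  also have "\<dots> = 2 * sine_moment a" by (simp add: sine_moment_def)
  finally show ?thesis .
qed

text \<open>The integrand of the left-hand side is the derivative of
  \<open>(2 * sin x) powr (2 * a + 1) * cos x\<close>, once \<open>cos x ^ 2\<close> is replaced by
  \<open>1 - sin x ^ 2\<close>. The boundary value at 0 vanishes, and the one at \<open>pi/4\<close>
  is \<open>sqrt 2 powr (2 * a)\<close>.\<close>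

lemma sine_moment_recurrence:
  assumes "a \<ge> 0"
  shows "(4 * a + 2) * sine_moment a - (a + 1) * sine_moment (a + 1) = 2 powr a"
proof -
  let ?K = "\<lambda>a x. exp (2 * a * ln (2 * sin x))"
  let ?F = "\<lambda>x. (2 * sin x) powr (2 * a + 1) * cos x"
  have "((\<lambda>x. (4 * a + 2) * ?K a x - (a + 1) * ?K (a + 1) x) has_integral
      (?F (pi/4) - ?F 0)) {0..pi/4}"
  proof (rule fundamental_theorem_of_calculus_interior)
    have "sin x \<ge> 0" if "x \<in> {0..pi/4}" for x
      using that by (intro sin_ge_zero) auto
    then show "continuous_on {0..pi/4} ?F"
      using assms by (intro continuous_intros continuous_on_powr') auto
    fix x :: real assume x: "x \<in> {0<..<pi/4}"
    then have s: "sin x > 0" using two_sin_bounds[of x] by auto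
    have p: "(2 * sin x) powr (2 * a) = ?K a x" using s by (simp add: powr_def)
    have p1: "(2 * sin x) powr (2 * a + 1) = 2 * sin x * ?K a x"
      using s p by (simp add: powr_add)
    have "(?F has_real_derivative
        ((2 * a + 1) * (2 * sin x) powr (2 * a) * (2 * cos x)) * cos x
         - (2 * sin x) powr (2 * a + 1) * sin x) (at x)"
      using s by (auto intro!: derivative_eq_intros)
    also have "((2 * a + 1) * (2 * sin x) powr (2 * a) * (2 * cos x)) * cos x
         - (2 * sin x) powr (2 * a + 1) * sin x =
         (4 * a + 2) * ?K a x * (cos x)\<^sup>2 - 2 * (sin x)\<^sup>2 * ?K a x"
      unfolding p p1 by (simp add: power2_eq_square algebra_simps)
    also have "\<dots> = (4 * a + 2) * ?K a x - (a + 1) * ?K (a + 1) x"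
      using x by (subst exp_ln_two_sin_plus1) (auto simp: cos_squared_eq algebra_simps)
    finally show "(?F has_vector_derivative (4 * a + 2) * ?K a x - (a + 1) * ?K (a + 1) x) (at x)"
      by (simp add: has_real_derivative_iff_has_vector_derivative)
  qed auto
  moreover have "((\<lambda>x. (4 * a + 2) * ?K a x - (a + 1) * ?K (a + 1) x) has_integral
      (4 * a + 2) * sine_moment a - (a + 1) * sine_moment (a + 1)) {0..pi/4}"
    unfolding sine_moment_def
    by (intro has_integral_diff has_integral_mult_right integrable_integral integrable_sine_moment)
      (use assms in auto)
  ultimately have "(4 * a + 2) * sine_moment a - (a + 1) * sine_moment (a + 1) = ?F (pi/4) - ?F 0"
    by (rule has_integral_unique[rotated])
  also have "\<dots> = sqrt 2 powr (2 * a)"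
    by (simp add: sin_45 cos_45 powr_add)
  also have "\<dots> = 2 powr a" by (simp add: powr_half_sqrt[symmetric] powr_powr)
  finally show ?thesis .
qed

lemma Ls_pi_half: "Ls (Suc n) (pi/2) = - 2 * log_sine_moment n"
proof -
  have "((\<lambda>x. ln (2 * sin x) ^ n) has_integral log_sine_moment n) {0..pi/4}"
    unfolding log_sine_moment_def by (rule integrable_integral[OF integrable_ln_sin_power])
  from has_integral_stretch_real[OF this, of "1/2"]
  have "((\<lambda>x. ln (2 * sin (x/2)) ^ n) has_integral 2 * log_sine_moment n) ((\<lambda>x. x / (1/2)) ` {0..pi/4})"
    by simp
  also have "(\<lambda>x. x / (1/2)) ` {0..pi/4} = {0..pi/2}"
    by (subst image_divide_atLeastAtMost) auto
  finally show ?thesis unfolding Ls_def by (simp add: integral_unique)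
qed

subsection \<open>The first log-sine integral\<close>

text \<open>The inverse tangent integral \<open>Ti_2\<close>, the antiderivative of
  \<open>arctan x / x\<close> vanishing at 0; its value at 1 is Catalan's constant.\<close>

definition arctan_integral :: "real \<Rightarrow> real" where
  "arctan_integral x = (\<Sum>n. (-1) ^ n * x ^ (2 * n + 1) / (2 * real n + 1) ^ 2)"

lemma summable_inverse_odd_squares: "summable (\<lambda>n. 1 / (2 * real n + 1) ^ 2)"
proof (rule summable_comparison_test')
  show "summable (\<lambda>n. 1 / (real n + 1) ^ 2)"
    using inverse_squares_sums by (simp add: sums_iff add.commute)
  show "norm (1 / (2 * real n + 1) ^ 2) \<le> 1 / (real n + 1) ^ 2" for n
    by (auto intro!: divide_left_mono power_mono)
qed

lemma arctan_integral_continuous: "continuous_on {0..1} arctan_integral"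
proof -
  have "uniform_limit {0..1} (\<lambda>N x. \<Sum>n<N. (-1) ^ n * x ^ (2 * n + 1) / (2 * real n + 1) ^ 2)
      (\<lambda>x. \<Sum>n. (-1) ^ n * x ^ (2 * n + 1) / (2 * real n + 1) ^ 2) sequentially"
    by (rule Weierstrass_m_test[OF _ summable_inverse_odd_squares])
      (auto simp: abs_mult power_abs intro!: divide_right_mono mult_le_one power_le_one)
  then have "continuous_on {0..1} (\<lambda>x::real. \<Sum>n. (-1) ^ n * x ^ (2 * n + 1) / (2 * real n + 1) ^ 2)"
    by (rule uniform_limit_theorem[rotated]) (auto intro!: always_eventually continuous_intros)
  then show ?thesis by (simp add: arctan_integral_def[abs_def])
qed

text \<open>On (0, 1) the function is \<open>y * g (y^2)\<close> for a power series
  \<open>g\<close>. The product rule gives \<open>g (x^2) + 2 * x^2 * g' (x^2)\<close>, whose terms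
  carry the factor \<open>2 * n + 1\<close>; it cancels one factor of the denominator and leaves the
  arctangent series divided by \<open>x\<close>.\<close>

lemma arctan_integral_derivative:
  assumes "0 < x" "x < 1"
  shows "(arctan_integral has_real_derivative arctan x / x) (at x)"
proof -
  define c :: "nat \<Rightarrow> real" where "c n = (-1) ^ n / (2 * real n + 1) ^ 2" for n
  have c: "summable (\<lambda>n. c n * y ^ n)" if "norm y < 1" for y
  proof (rule summable_comparison_test'[OF summable_inverse_odd_squares])
    show "norm (c n * y ^ n) \<le> 1 / (2 * real n + 1) ^ 2" for n
      using that by (auto simp: c_def abs_mult power_abs intro!: divide_right_mono power_le_one)
  qed
  have x2: "norm (x\<^sup>2) < 1" using assms by (simp add: power_less_one_iff abs_square_less_1)
  define g where "g y = (\<Sum>n. c n * y ^ n)" for y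
  have g: "(\<lambda>n. c n * (x\<^sup>2) ^ n) sums g (x\<^sup>2)"
    using c[OF x2] by (simp add: g_def summable_sums)
  define D where "D = (\<Sum>n. diffs c n * (x\<^sup>2) ^ n)"
  have D1: "(g has_real_derivative D) (at (x\<^sup>2))"
    unfolding g_def[abs_def] D_def by (rule termdiffs_strong'[OF c x2])
  have D2: "(\<lambda>n. diffs c n * (x\<^sup>2) ^ n) sums D"
    unfolding D_def by (intro summable_sums termdiff_converges[OF x2] c)
  have "(\<lambda>n. diffs c n * (x\<^sup>2) ^ n * x\<^sup>2) sums (D * x\<^sup>2)" by (intro sums_mult2 D2)
  then have "(\<lambda>n. real (Suc n) * c (Suc n) * (x\<^sup>2) ^ Suc n) sums (D * x\<^sup>2)"
    by (simp add: diffs_def mult_ac)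
  \<comment> \<open>The shifted index may be undone at no cost: the term at \<open>n = 0\<close> is
    zero.\<close>
  then have D': "(\<lambda>n. real n * c n * (x\<^sup>2) ^ n) sums (D * x\<^sup>2)"
    by (subst (asm) sums_Suc_iff) simp
  have "(\<lambda>n. c n * (x\<^sup>2) ^ n + 2 * (real n * c n * (x\<^sup>2) ^ n)) sums (g (x\<^sup>2) + 2 * (D * x\<^sup>2))"
    by (intro sums_add sums_mult g D')
  also have "(\<lambda>n. c n * (x\<^sup>2) ^ n + 2 * (real n * c n * (x\<^sup>2) ^ n)) =
      (\<lambda>n. (-1) ^ n * (1 / real (n * 2 + 1) * x ^ (n * 2 + 1)) / x)"
  proof
    fix n
    have "c n * (x\<^sup>2) ^ n + 2 * (real n * c n * (x\<^sup>2) ^ n) = (2 * real n + 1) * c n * (x\<^sup>2) ^ n"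
      by (simp add: algebra_simps)
    also have "(2 * real n + 1) * c n = (-1) ^ n / (2 * real n + 1)"
      by (simp add: c_def power2_eq_square)
    also have "(x\<^sup>2) ^ n = x ^ (n * 2)" by (simp add: power_mult[symmetric] mult.commute)
    finally show "c n * (x\<^sup>2) ^ n + 2 * (real n * c n * (x\<^sup>2) ^ n) =
        (-1) ^ n * (1 / real (n * 2 + 1) * x ^ (n * 2 + 1)) / x"
      using assms by (simp add: mult.commute add.commute flip: power_mult)
  qed
  finally have "(\<lambda>n. (-1) ^ n * (1 / real (n * 2 + 1) * x ^ (n * 2 + 1)) / x) sums
      (g (x\<^sup>2) + 2 * (D * x\<^sup>2))" .
  moreover have "(\<lambda>n. (-1) ^ n * (1 / real (n * 2 + 1) * x ^ (n * 2 + 1)) / x) sums (arctan x / x)"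
    using assms arctan_series[of x] summable_arctan_series[of x]
    by (intro sums_divide) (simp add: sums_iff)
  ultimately have eq: "g (x\<^sup>2) + 2 * (D * x\<^sup>2) = arctan x / x" by (rule sums_unique2)
  have "((\<lambda>x. g (x\<^sup>2)) has_real_derivative D * (2 * x)) (at x)"
    by (rule DERIV_chain2[where f = g and g = "\<lambda>x. x\<^sup>2", OF D1]) (auto intro!: derivative_eq_intros)
  then have "((\<lambda>x. x * g (x\<^sup>2)) has_real_derivative g (x\<^sup>2) + D * (2 * x) * x) (at x)"
    by (auto intro!: derivative_eq_intros)
  also have "g (x\<^sup>2) + D * (2 * x) * x = arctan x / x"
    by (simp add: eq[symmetric] power2_eq_square)
  finally have "((\<lambda>x. x * g (x\<^sup>2)) has_real_derivative arctan x / x) (at x)" .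
  moreover have "eventually (\<lambda>y. y * g (y\<^sup>2) = arctan_integral y) (nhds x)"
  proof (rule eventually_mono)
    show "eventually (\<lambda>y. y \<in> {0<..<1}) (nhds x)"
      using assms by (intro eventually_nhds_in_open) auto
    fix y :: real assume y: "y \<in> {0<..<1}"
    then have "norm (y\<^sup>2) < 1" by (simp add: abs_square_less_1)
    then have "(\<lambda>n. y * (c n * (y\<^sup>2) ^ n)) sums (y * g (y\<^sup>2))"
      using c by (intro sums_mult) (simp add: g_def summable_sums)
    also have "(\<lambda>n. y * (c n * (y\<^sup>2) ^ n)) = (\<lambda>n. (-1) ^ n * y ^ (2 * n + 1) / (2 * real n + 1) ^ 2)"
      by (auto simp: c_def fun_eq_iff simp flip: power_mult)
    finally show "y * g (y\<^sup>2) = arctan_integral y"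
      by (simp add: arctan_integral_def sums_iff)
  qed
  ultimately show ?thesis by (subst (asm) DERIV_cong_ev) auto
qed

lemma tan_le_one:
  assumes "0 \<le> x" "x \<le> pi/4"
  shows "0 \<le> tan x" "tan x \<le> 1"
proof -
  show "0 \<le> tan x" using assms by (intro tan_pos_pi2_le) (use pi_gt_zero in linarith)+
  show "tan x \<le> 1" using assms tan_mono_le[of x "pi/4"] by (simp add: tan_45)
qed

text \<open>Integration by parts gives the antiderivative
  \<open>x * ln (tan x) - arctan_integral (tan x)\<close>, because \<open>arctan (tan x) = x\<close>
  makes the remaining terms of its derivative cancel. At \<open>pi/4\<close> the logarithm vanishes
  and \<open>arctan_integral 1\<close> remains; at 0 both parts are 0.\<close>

lemma has_integral_ln_tan:
  "((\<lambda>x. ln (tan x)) has_integral - catalan_const) {0..pi/4}"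
proof -
  let ?F = "\<lambda>x. x * ln (tan x) - arctan_integral (tan x)"
  have "((\<lambda>x. ln (tan x)) has_integral (?F (pi/4) - ?F 0)) {0..pi/4}"
  proof (rule fundamental_theorem_of_calculus_interior)
    have pos: "0 < cos x" "0 < tan x" if "0 < x" "x \<le> pi/4" for x
      using that cos_gt_zero_pi[of x] tan_gt_zero[of x] pi_gt_zero by linarith+
    have "continuous_on {0..pi/4} (\<lambda>x. x * ln (tan x))"
    proof (rule continuous_on_IccI)
      \<comment> \<open>The limit agrees with the value at 0, which is a product with the factor
        0.\<close>
      have "((\<lambda>x::real. x * ln (tan x)) \<longlongrightarrow> 0) (at_right 0)" by real_asymp
      then show "((\<lambda>x::real. x * ln (tan x)) \<longlongrightarrow> 0 * ln (tan 0)) (at_right 0)" by simp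
    next
      show "((\<lambda>x. x * ln (tan x)) \<longlongrightarrow> pi/4 * ln (tan (pi/4))) (at_left (pi/4))"
        by (intro tendsto_intros) (use pos[of "pi/4"] in auto)
    next
      show "(\<lambda>x. x * ln (tan x)) \<midarrow>x\<rightarrow> x * ln (tan x)" if "0 < x" "x < pi/4" for x
        using that pos[of x] by (intro tendsto_intros) auto
    qed auto
    moreover have "continuous_on {0..pi/4} (\<lambda>x. arctan_integral (tan x))"
    proof (rule continuous_on_compose2[OF arctan_integral_continuous])
      have "cos x \<noteq> 0" if "x \<in> {0..pi/4}" for x
        using that pos[of x] by (cases "x = 0") auto
      then show "continuous_on {0..pi/4} (tan :: real \<Rightarrow> real)" by (intro continuous_intros) auto
    qed (use tan_le_one in auto)
    ultimately show "continuous_on {0..pi/4} ?F" by (rule continuous_on_diff)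
    fix x :: real assume x: "x \<in> {0<..<pi/4}"
    then have p: "0 < cos x" "0 < tan x" using pos[of x] by auto
    have t1: "tan x < 1" using x tan_monotone[of x "pi/4"] by (simp add: tan_45)
    have arctan: "arctan (tan x) = x" using x by (intro arctan_tan) auto
    have "(?F has_real_derivative
        (ln (tan x) + x * (inverse ((cos x)\<^sup>2) / tan x)
          - arctan (tan x) / tan x * inverse ((cos x)\<^sup>2))) (at x)"
      using p by (auto intro!: derivative_eq_intros DERIV_chain2[OF arctan_integral_derivative] t1)
    also have "ln (tan x) + x * (inverse ((cos x)\<^sup>2) / tan x)
          - arctan (tan x) / tan x * inverse ((cos x)\<^sup>2) = ln (tan x)"
      by (simp add: arctan)
    finally show "(?F has_vector_derivative ln (tan x)) (at x)"
      by (simp add: has_real_derivative_iff_has_vector_derivative)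
  qed simp
  also have "?F (pi/4) - ?F 0 = - catalan_const"
    by (simp add: tan_45 arctan_integral_def catalan_const_def)
  finally show ?thesis .
qed

text \<open>With \<open>J\<close> and \<open>J'\<close> the integrals of \<open>ln (2 sin x)\<close> and \<open>ln (2 cos x)\<close> over \<open>[0, \<pi>/4]\<close>, the duplication
  formula gives \<open>J + J' = (J + J') / 2\<close>, whence \<open>J + J' = 0\<close>, while \<open>J - J'\<close> is the integral
  of \<open>ln (tan x)\<close>.\<close>

lemma log_sine_moment_1: "log_sine_moment 1 = - catalan_const / 2"
proof -
  define J where "J = log_sine_moment 1"
  define J' where "J' = J + catalan_const"
  have J: "((\<lambda>x. ln (2 * sin x)) has_integral J) {0..pi/4}"
    using integrable_integral[OF integrable_ln_sin_power[of 1]] by (simp add: J_def log_sine_moment_def)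
  have pos: "0 < cos x" "0 < sin x" "cos x \<noteq> 0" "sin x \<noteq> 0" if "0 \<le> x" "x * 4 \<le> pi" "x \<noteq> 0" for x
    using that cos_gt_zero_pi[of x] sin_gt_zero[of x] pi_gt_zero by linarith+
  have "((\<lambda>x. ln (2 * sin x) - ln (tan x)) has_integral J') {0..pi/4}"
    using has_integral_diff[OF J has_integral_ln_tan] by (simp add: J'_def)
  then have J': "((\<lambda>x. ln (2 * cos x)) has_integral J') {0..pi/4}"
    by (rule has_integral_spike_finite[of "{0}", rotated 2])
      (use pos in \<open>auto simp: tan_def ln_mult ln_div\<close>)
  have "((\<lambda>x. ln (2 * sin x) + ln (2 * cos x)) has_integral (J + J')) {0..pi/4}"
    by (intro has_integral_add J J')
  then have sum: "((\<lambda>x. ln (2 * sin (2 * x))) has_integral (J + J')) {0..pi/4}"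
    by (rule has_integral_spike_finite[of "{0}", rotated 2])
      (use pos ln_realpow[of 2 2] in \<open>auto simp: sin_double ln_mult\<close>)
  \<comment> \<open>The reflection of \<open>x\<close> to \<open>pi/2 - x\<close> turns the cosine
    integral over [0, \<open>pi/4\<close>] into the sine integral over
    [\<open>pi/4\<close>, \<open>pi/2\<close>].\<close>
  have "((\<lambda>x. ln (2 * cos (-1 *\<^sub>R x + pi/2))) has_integral (1 / \<bar>-1\<bar> ^ DIM(real)) *\<^sub>R J')
      ((\<lambda>x. (1 / -1) *\<^sub>R x + - ((1 / -1) *\<^sub>R (pi/2))) ` cbox 0 (pi/4))"
    by (rule has_integral_affinity) (use J' in auto)
  also have "(\<lambda>x. (1 / -1) *\<^sub>R x + - ((1 / -1) *\<^sub>R (pi/2))) ` cbox 0 (pi/4) = {pi/4..pi/2}"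
    using image_diff_atLeastAtMost[of "pi/2" 0 "pi/4"] by (simp add: algebra_simps)
  also have "(\<lambda>x. ln (2 * cos (-1 *\<^sub>R x + pi/2))) = (\<lambda>x. ln (2 * sin x))"
    by (simp add: cos_diff)
  finally have "((\<lambda>x. ln (2 * sin x)) has_integral J') {pi/4..pi/2}" by simp
  with J have "((\<lambda>x. ln (2 * sin x)) has_integral (J + J')) {0..pi/2}"
    by (intro has_integral_combine[of 0 "pi/4" "pi/2"]) auto
  from has_integral_stretch_real[OF this, of 2]
  have "((\<lambda>x. ln (2 * sin (2 * x))) has_integral (J + J') / 2) ((\<lambda>x. x / 2) ` {0..pi/2})"
    by simp
  also have "(\<lambda>x. x / 2) ` {0..pi/2} = {0..pi/4}"
    by simp
  finally have "J + J' = (J + J') / 2" using has_integral_unique sum by blast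
  then show ?thesis unfolding J_def[symmetric] by (simp add: J'_def)
qed

subsection \<open>Termwise differentiation\<close>

text \<open>Induction on \<open>n\<close>: restricted to the real axis, the complex derivative is
  the derivative of a real-valued function. This lets the real iterated derivatives in
  \<open>T_term\<close> be handled by complex analysis.\<close>

lemma higher_deriv_of_real:
  fixes f :: "real \<Rightarrow> real" and g :: "complex \<Rightarrow> complex"
  assumes holo: "g holomorphic_on S" and S: "open S"
    and eq: "\<And>x. of_real x \<in> S \<Longrightarrow> g (of_real x) = of_real (f x)"
    and x: "of_real x \<in> S"
  shows "(deriv ^^ n) g (of_real x) = of_real ((deriv ^^ n) f x)"
  using x
proof (induction n arbitrary: x)
  case (Suc n)
  let ?G = "(deriv ^^ n) g" and ?F = "(deriv ^^ n) f"
  let ?D = "deriv ?G (of_real x)"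
  have "(?G has_field_derivative ?D) (at (of_real x))"
    by (rule holomorphic_derivI[OF holomorphic_higher_deriv[OF holo S] S Suc.prems])
  then have "((\<lambda>y. ?G (of_real y)) has_vector_derivative ?D) (at x)"
    by (rule has_vector_derivative_real_field)
  then have D: "((\<lambda>y. complex_of_real (?F y)) has_vector_derivative ?D) (at x)"
  proof (rule has_vector_derivative_transform_within_open)
    show "open (of_real -` S :: real set)" using S by (intro open_vimage continuous_intros)
  qed (use Suc in auto)
  have "(?F has_vector_derivative Re ?D) (at x)"
    using bounded_linear.has_vector_derivative[OF bounded_linear_Re D] by simp
  then have "deriv ?F x = Re ?D"
    by (intro DERIV_imp_deriv) (simp add: has_real_derivative_iff_has_vector_derivative)
  \<comment> \<open>The imaginary part is constantly 0 along the real axis, so its derivative is 0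
    too.\<close>
  moreover have "((\<lambda>y. 0) has_vector_derivative Im ?D) (at x)"
    using bounded_linear.has_vector_derivative[OF bounded_linear_Im D] by simp
  then have "Im ?D = 0"
    using vector_derivative_unique_at has_vector_derivative_const by blast
  ultimately show ?case by (simp add: complex_eq_iff)
qed (use eq in auto)

text \<open>This is \<open>2^z f(z) / 2\<close>, whose \<open>r\<close>-th derivative at \<open>n + 1\<close> is the \<open>n\<close>-th term of \<open>T_r\<close>.\<close>

definition weighted_beta :: "'a :: Gamma \<Rightarrow> 'a" where
  "weighted_beta z = Gamma z ^ 2 / (2 * Gamma (2 * z)) * (exp (of_real (ln 2) * z) / 2)"

lemma Re_pos_not_nonpos_Int: "Re z > 0 \<Longrightarrow> z \<notin> \<int>\<^sub>\<le>\<^sub>0"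
  by (auto elim!: nonpos_Ints_cases)

lemma higher_deriv_exp_mult:
  "(deriv ^^ n) (\<lambda>z. exp (c * z) / 2) = (\<lambda>z. c ^ n * exp (c * z) / 2)" for c :: complex
proof (induction n)
  case (Suc n)
  have "deriv (\<lambda>z. c ^ n * exp (c * z) / 2) z = c ^ Suc n * exp (c * z) / 2" for z
    by (rule DERIV_imp_deriv) (auto intro!: derivative_eq_intros)
  then have "deriv (\<lambda>z. c ^ n * exp (c * z) / 2) = (\<lambda>z. c ^ Suc n * exp (c * z) / 2)"
    by (rule ext)
  then show ?case by (simp only: funpow.simps o_apply Suc)
qed auto

lemma open_Re_pos: "open {z. Re z > 0}"
  by (rule open_halfspace_Re_gt)

lemma complex_beta_holomorphic:
  "(\<lambda>z. Gamma z ^ 2 / (2 * Gamma (2 * z))) holomorphic_on {z. Re z > 0}"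
proof -
  have "z \<notin> \<int>\<^sub>\<le>\<^sub>0 \<and> 2 * z \<notin> \<int>\<^sub>\<le>\<^sub>0" if "Re z > 0" for z
    using that Re_pos_not_nonpos_Int[of z] Re_pos_not_nonpos_Int[of "2 * z"] by auto
  then show ?thesis by (intro holomorphic_intros) (auto simp: Gamma_eq_zero_iff)
qed

lemma weighted_beta_holomorphic: "weighted_beta holomorphic_on {z. Re z > 0}"
  unfolding weighted_beta_def[abs_def]
  by (intro holomorphic_on_mult complex_beta_holomorphic) (intro holomorphic_intros; simp)

lemma weighted_beta_of_real:
  "weighted_beta (complex_of_real x) = of_real (weighted_beta x)"
  unfolding weighted_beta_def using Gamma_complex_of_real[of "2 * x"]
  by (simp add: Gamma_complex_of_real flip: exp_of_real)

text \<open>By the Leibniz rule, each derivative falling on \<open>exp (ln 2 * z) / 2\<close>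
  contributes a factor \<open>ln 2\<close>, and the exponential factor itself is
  \<open>2 ^ n\<close> at \<open>n + 1\<close>. The result is the binomial expansion in
  \<open>D_plus_log2_pow\<close>.\<close>

lemma T_term_eq_higher_deriv:
  "complex_of_real (T_term r n) = (deriv ^^ r) weighted_beta (of_nat (n + 1))"
proof -
  let ?z = "of_nat (n + 1) :: complex"
  have z: "?z = of_real (real (n + 1))" by simp
  have d: "(deriv ^^ j) (\<lambda>z. Gamma z ^ 2 / (2 * Gamma (2 * z))) ?z =
      of_real ((deriv ^^ j) half_central_beta (real (n + 1)))" for j
    unfolding z
  proof (rule higher_deriv_of_real[OF complex_beta_holomorphic open_Re_pos])
    show "Gamma (complex_of_real x) ^ 2 / (2 * Gamma (2 * complex_of_real x)) = of_real (half_central_beta x)" for x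
      using Gamma_complex_of_real[of "2 * x"] by (simp add: Gamma_complex_of_real half_central_beta_def)
  qed simp
  have "exp (complex_of_real (ln 2) * ?z) = of_real (exp (ln 2 * real (n + 1)))"
    unfolding z by (simp flip: exp_of_real)
  also have "exp (ln 2 * real (n + 1)) = 2 ^ (n + 1)"
    by (subst mult.commute, subst exp_of_nat_mult) simp
  finally have e: "exp (complex_of_real (ln 2) * ?z) = 2 * 2 ^ n" by simp
  have "(deriv ^^ r) weighted_beta ?z =
     (\<Sum>j=0..r. of_nat (r choose j) *
       (deriv ^^ j) (\<lambda>z. Gamma z ^ 2 / (2 * Gamma (2 * z))) ?z *
       (deriv ^^ (r - j)) (\<lambda>z. exp (of_real (ln 2) * z) / 2) ?z)"
    unfolding weighted_beta_def[abs_def]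
    by (rule higher_deriv_mult[OF complex_beta_holomorphic _ open_Re_pos])
      (auto intro!: holomorphic_intros)
  also have "\<dots> = of_real (T_term r n)"
    unfolding T_term_def D_plus_log2_pow_def d higher_deriv_exp_mult e
    by (simp add: sum_distrib_left mult_ac)
  finally show ?thesis ..
qed

section \<open>Functional equation of the summand and holomorphy of the series\<close>

lemma weighted_beta_plus1:
  assumes "Re z > 0"
  shows "weighted_beta (z + 1) = weighted_beta z * (z / (2 * z + 1))"
proof -
  have z: "z \<notin> \<int>\<^sub>\<le>\<^sub>0" "2 * z \<notin> \<int>\<^sub>\<le>\<^sub>0" "2 * z + 1 \<notin> \<int>\<^sub>\<le>\<^sub>0"
    using assms by (auto intro!: Re_pos_not_nonpos_Int)
  then have nz: "z \<noteq> 0" "2 * z + 1 \<noteq> 0" "Gamma (2 * z) \<noteq> 0" by (auto simp: Gamma_eq_zero_iff)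
  have "Gamma (2 * (z + 1)) = Gamma (2 * z + 1 + 1)" by (simp add: algebra_simps)
  also have "\<dots> = (2 * z + 1) * (2 * z) * Gamma (2 * z)"
    by (simp only: Gamma_plus1[OF z(2)] Gamma_plus1[OF z(3)] mult.assoc)
  finally have G: "Gamma (2 * (z + 1)) = (2 * z + 1) * (2 * z) * Gamma (2 * z)" .
  have "exp (complex_of_real (ln 2)) = 2" by (subst exp_of_real) simp
  then have e: "exp (of_real (ln 2) * (z + 1)) = 2 * exp (of_real (ln 2) * z)"
    by (simp add: ring_distribs exp_add)
  show ?thesis
    unfolding weighted_beta_def G e Gamma_plus1[OF z(1)]
    using nz by (simp add: power2_eq_square mult_ac)
qed

text \<open>In the right half-plane \<open>|2 * w|\<close> is at most \<open>|2 * w + 1|\<close>, so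
  each shift by 1 multiplies the norm by at most 1/2.\<close>

lemma norm_weighted_beta_shift:
  assumes "Re z > 0"
  shows "norm (weighted_beta (z + of_nat n)) \<le> norm (weighted_beta z) * (1/2) ^ n"
proof (induction n)
  case (Suc n)
  let ?w = "z + of_nat n"
  have w: "Re ?w > 0" using assms by simp
  have "norm (2 * ?w) \<le> norm (2 * ?w + 1)"
    unfolding cmod_def using w by (intro real_sqrt_le_mono add_mono) (auto intro: power_mono)
  moreover have "2 * ?w + 1 \<noteq> 0" using w by (auto simp: complex_eq_iff)
  ultimately have "norm (?w / (2 * ?w + 1)) \<le> 1/2"
    by (simp only: norm_divide norm_mult) (simp add: field_simps)
  then have "norm (weighted_beta ?w * (?w / (2 * ?w + 1))) \<le> norm (weighted_beta z) * (1/2) ^ n * (1/2)"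
    unfolding norm_mult by (intro mult_mono Suc) auto
  then show ?case using weighted_beta_plus1[OF w] by (simp add: add_ac)
qed auto

text \<open>This is \<open>S(z - 1)\<close>, so the derivatives of \<open>S\<close> at 0 are those
  of the series at 1.\<close>

definition weighted_beta_series :: "complex \<Rightarrow> complex" where
  "weighted_beta_series z = (\<Sum>n. weighted_beta (z + of_nat n))"

text \<open>The closed disc is compact and lies in the right half-plane, so
  \<open>weighted_beta\<close> is bounded on it and the geometric decay under shifts supplies the
  majorant.\<close>

lemma weighted_beta_series_uniform_limit:
  "uniform_limit (cball 1 (1/2)) (\<lambda>N z. \<Sum>n<N. weighted_beta (z + of_nat n))
     weighted_beta_series sequentially"
proof -
  let ?B = "cball 1 (1/2) :: complex set"
  have pos: "Re z > 0" if "z \<in> ?B" for z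
    using that abs_Re_le_cmod[of "1 - z"] by (auto simp: dist_norm)
  have "continuous_on ?B weighted_beta"
    by (intro holomorphic_on_imp_continuous_on holomorphic_on_subset[OF weighted_beta_holomorphic])
      (use pos in auto)
  then have "bounded (weighted_beta ` ?B)"
    by (intro compact_imp_bounded compact_continuous_image) auto
  then obtain M where "\<forall>w \<in> weighted_beta ` ?B. norm w \<le> M"
    unfolding bounded_iff by blast
  then have M: "norm (weighted_beta z) \<le> M" if "z \<in> ?B" for z
    using that by blast
  show ?thesis unfolding weighted_beta_series_def[abs_def]
  proof (rule Weierstrass_m_test)
    show "summable (\<lambda>n. M * (1/2) ^ n)" by (intro summable_mult summable_geometric) simp
    fix n and z :: complex assume z: "z \<in> cball 1 (1/2)"
    show "norm (weighted_beta (z + of_nat n)) \<le> M * (1/2) ^ n"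
      by (rule order_trans[OF norm_weighted_beta_shift[OF pos[OF z]] mult_right_mono[OF M[OF z]]]) auto
  qed
qed

lemma weighted_beta_shift_holomorphic:
  "(\<lambda>z. weighted_beta (z + of_nat n)) holomorphic_on ball 1 (1/2)"
proof -
  have "Re z > 0" if "z \<in> ball 1 (1/2)" for z
    using that abs_Re_le_cmod[of "1 - z"] by (auto simp: dist_norm)
  then show ?thesis
    by (intro holomorphic_on_compose_gen[OF _ weighted_beta_holomorphic, unfolded o_def] holomorphic_intros)
      (auto simp: add_pos_nonneg)
qed

lemma weighted_beta_series_holomorphic: "weighted_beta_series holomorphic_on ball 1 (1/2)"
proof (rule holomorphic_uniform_sequence[OF open_ball])
  show "(\<lambda>z. \<Sum>n<N. weighted_beta (z + of_nat n)) holomorphic_on ball 1 (1/2)" for N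
    by (intro holomorphic_on_sum weighted_beta_shift_holomorphic)
  fix z :: complex assume "z \<in> ball 1 (1/2)"
  then obtain d where "d > 0" "cball z d \<subseteq> ball 1 (1/2)"
    using open_contains_cball open_ball by blast
  then show "\<exists>d>0. cball z d \<subseteq> ball 1 (1/2) \<and>
      uniform_limit (cball z d) (\<lambda>N z. \<Sum>n<N. weighted_beta (z + of_nat n)) weighted_beta_series sequentially"
    using uniform_limit_on_subset[OF weighted_beta_series_uniform_limit] ball_subset_cball by blast
qed

lemma higher_deriv_sum:
  assumes "\<And>i. i \<in> I \<Longrightarrow> f i holomorphic_on S" "open S" "z \<in> S"
  shows "(deriv ^^ n) (\<lambda>z. \<Sum>i\<in>I. f i z) z = (\<Sum>i\<in>I. (deriv ^^ n) (f i) z)"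
  using assms(1)
proof (induction I rule: infinite_finite_induct)
  case (insert i I)
  then show ?case
    using assms(2,3) by (simp add: higher_deriv_add[of "f i" S] holomorphic_on_sum)
qed (auto simp: funpow_0)

text \<open>Uniform convergence of holomorphic functions passes to derivatives of every order, so
  the series may be differentiated term by term at 1.\<close>

lemma T_term_sums: "(\<lambda>n. complex_of_real (T_term r n)) sums (deriv ^^ r) weighted_beta_series 1"
proof -
  have "(\<lambda>N. (deriv ^^ r) (\<lambda>z. \<Sum>n<N. weighted_beta (z + of_nat n)) 1) \<longlonglongrightarrow>
      (deriv ^^ r) weighted_beta_series 1"
  proof (rule higher_deriv_complex_uniform_limit)
    show "uniform_limit (ball 1 (1/2)) (\<lambda>N z. \<Sum>n<N. weighted_beta (z + of_nat n))
        weighted_beta_series sequentially"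
      by (rule uniform_limit_on_subset[OF weighted_beta_series_uniform_limit ball_subset_cball])
  qed (auto intro!: always_eventually holomorphic_on_sum weighted_beta_shift_holomorphic)
  moreover have "(deriv ^^ r) (\<lambda>z. \<Sum>n<N. weighted_beta (z + of_nat n)) 1 =
      (\<Sum>n<N. complex_of_real (T_term r n))" for N
  proof (subst higher_deriv_sum[where S = "ball 1 (1/2)"])
    \<comment> \<open>The shift is written as an affine map of slope 1 to fit the chain rule for
      linear substitutions.\<close>
    have "(deriv ^^ r) (\<lambda>z. weighted_beta (1 * z + of_nat n)) (1 :: complex) =
        1 ^ r * (deriv ^^ r) weighted_beta (1 * 1 + of_nat n)" for n
      by (rule higher_deriv_compose_linear'[OF weighted_beta_holomorphic open_Re_pos open_Re_pos])
        (auto simp: add_pos_nonneg)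
    then show "(\<Sum>n<N. (deriv ^^ r) (\<lambda>z. weighted_beta (z + of_nat n)) 1) =
        (\<Sum>n<N. complex_of_real (T_term r n))"
      by (simp add: T_term_eq_higher_deriv add.commute)
  qed (use weighted_beta_shift_holomorphic in auto)
  ultimately show ?thesis by (simp add: sums_def)
qed

subsection \<open>Telescoping\<close>

text \<open>This is \<open>1 / (2z choose z)\<close>.\<close>

definition inverse_central_binomial :: "'a :: Gamma \<Rightarrow> 'a" where
  "inverse_central_binomial z = Gamma (z + 1) ^ 2 * rGamma (2 * z + 1)"

lemma inverse_central_binomial_plus1:
  assumes "a \<ge> 0"
  shows "inverse_central_binomial (a + 1 :: real) =
    inverse_central_binomial a * ((a + 1) / (4 * a + 2))"
proof -
  have nz: "a + 1 \<notin> \<int>\<^sub>\<le>\<^sub>0" "2 * a + 1 \<notin> \<int>\<^sub>\<le>\<^sub>0" "2 * a + 1 + 1 \<notin> \<int>\<^sub>\<le>\<^sub>0"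
    using assms by (auto elim!: nonpos_Ints_cases)
  have "rGamma (2 * (a + 1) + 1) * ((2 * a + 1) * (2 * a + 2)) =
      (2 * a + 1) * ((2 * a + 1 + 1) * rGamma (2 * a + 1 + 1 + 1))"
    by (simp add: algebra_simps)
  also have "\<dots> = rGamma (2 * a + 1)" by (simp only: rGamma_plus1)
  finally have R: "rGamma (2 * (a + 1) + 1) = rGamma (2 * a + 1) / ((2 * a + 1) * (2 * a + 2))"
    using assms by (subst nonzero_eq_divide_eq) auto
  have G: "Gamma (a + 1 + 1) = (a + 1) * Gamma (a + 1)" by (rule Gamma_plus1[OF nz(1)])
  have "inverse_central_binomial (a + 1) =
      inverse_central_binomial a * ((a + 1)\<^sup>2 / ((2 * a + 1) * (2 * a + 2)))"
    unfolding inverse_central_binomial_def R G by (simp add: power_mult_distrib)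
  also have "(a + 1)\<^sup>2 / ((2 * a + 1) * (2 * a + 2)) = (a + 1) / (4 * a + 2)"
    using assms by (simp add: divide_simps power2_eq_square) (simp add: algebra_simps)
  finally show ?thesis .
qed

lemma inverse_central_binomial_pos: "a \<ge> 0 \<Longrightarrow> inverse_central_binomial (a :: real) > 0"
  unfolding inverse_central_binomial_def
  by (intro mult_pos_pos zero_less_power Gamma_real_pos) (auto simp: rGamma_inverse_Gamma intro!: Gamma_real_pos)

text \<open>This expresses the summand through the right-hand side \<open>2 powr a\<close> of the
  sine moment recurrence.\<close>

lemma weighted_beta_eq_inverse_central_binomial:
  assumes "a \<ge> 0"
  shows "weighted_beta (a + 1 :: real) = inverse_central_binomial a * 2 powr a / (4 * a + 2)"
proof -
  have nz: "2 * a + 1 \<notin> \<int>\<^sub>\<le>\<^sub>0" using assms by (auto elim!: nonpos_Ints_cases)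
  have "Gamma (2 * (a + 1)) = Gamma (2 * a + 1 + 1)" by (simp add: algebra_simps)
  also have "\<dots> = (2 * a + 1) * Gamma (2 * a + 1)" by (rule Gamma_plus1[OF nz])
  finally have G: "Gamma (2 * (a + 1)) = (2 * a + 1) * Gamma (2 * a + 1)" .
  have "exp (ln 2 * (a + 1)) = 2 * 2 powr a" by (simp add: powr_def ring_distribs exp_add mult.commute)
  then show ?thesis
    unfolding weighted_beta_def inverse_central_binomial_def rGamma_inverse_Gamma G
    using assms by (simp add: field_simps)
qed

text \<open>Dividing the recurrence for the sine moments by the central binomial coefficient turns it
  into a telescoping one.\<close>

lemma weighted_beta_sums_sine_moment:
  assumes "a > 0"
  shows "(\<lambda>n. weighted_beta (a + 1 + real n)) sums (sine_moment a * inverse_central_binomial a)"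
proof -
  define L where "L n = sine_moment (a + real n) * inverse_central_binomial (a + real n)" for n
  \<comment> \<open>The moment bound 2 times the binomial ratio \<open>(b + 1) / (4 * b + 2)\<close>
    is \<open>(b + 1) / (2 * b + 1)\<close>. It decreases in \<open>b\<close>, so \<open>q\<close>
    bounds it for all \<open>b = a + n\<close>, and \<open>a > 0\<close> gives
    \<open>q < 1\<close>.\<close>
  define q where "q = (a + 1) / (2 * a + 1)"
  have q: "0 \<le> q" "q < 1" using assms by (auto simp: q_def)
  have step: "L n - L (Suc n) = weighted_beta (a + 1 + real n)" for n
  proof -
    define b where "b = a + real n"
    have b: "b \<ge> 0" using assms by (simp add: b_def)
    have "L n - L (Suc n) = sine_moment b * inverse_central_binomial b -
        sine_moment (b + 1) * inverse_central_binomial (b + 1)"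
      by (simp add: L_def b_def add_ac)
    also have "\<dots> = inverse_central_binomial b / (4 * b + 2) *
        ((4 * b + 2) * sine_moment b - (b + 1) * sine_moment (b + 1))"
      unfolding inverse_central_binomial_plus1[OF b] using b by (simp add: field_simps)
    also have "\<dots> = weighted_beta (b + 1)"
      unfolding sine_moment_recurrence[OF b] weighted_beta_eq_inverse_central_binomial[OF b] by simp
    finally show ?thesis by (simp add: b_def add_ac)
  qed
  have nonneg: "L n \<ge> 0" for n
    unfolding L_def using assms inverse_central_binomial_pos[of "a + real n"]
    by (intro mult_nonneg_nonneg sine_moment_nonneg) auto
  have "L (Suc n) \<le> L n * q" for n
  proof -
    define b where "b = a + real n"
    have b: "b \<ge> 0" using assms by (simp add: b_def)
    have "L (Suc n) = sine_moment (b + 1) * inverse_central_binomial (b + 1)"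
      by (simp add: L_def b_def add_ac)
    also have "\<dots> \<le> (2 * sine_moment b) * inverse_central_binomial (b + 1)"
      using b inverse_central_binomial_pos[of "b + 1"]
      by (intro mult_right_mono sine_moment_plus1_le) auto
    also have "\<dots> = L n * ((b + 1) / (2 * b + 1))"
      unfolding inverse_central_binomial_plus1[OF b] L_def b_def[symmetric]
      using b by (simp add: field_simps)
    also have "\<dots> \<le> L n * q"
    proof (intro mult_left_mono nonneg)
      have "1 / (2 * b + 1) \<le> 1 / (2 * a + 1)"
        using assms by (intro divide_left_mono) (auto simp: b_def)
      moreover have *: "(c + 1) / (2 * c + 1) = 1/2 + 1/2 * (1 / (2 * c + 1))" if "c \<ge> 0" for c :: real
        using that by (simp add: field_simps)
      ultimately show "(b + 1) / (2 * b + 1) \<le> q"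
        using *[of b] *[of a] b assms unfolding q_def by linarith
    qed
    finally show ?thesis .
  qed
  then have "L n \<le> L 0 * q ^ n" for n
    using q by (induction n) (auto intro: order_trans mult_right_mono simp flip: mult.assoc simp: mult.commute[of q])
  moreover have "(\<lambda>n. L 0 * q ^ n) \<longlonglongrightarrow> 0"
    using q by (intro tendsto_mult_right_zero LIMSEQ_realpow_zero)
  ultimately have "L \<longlonglongrightarrow> 0"
    using nonneg by (intro tendsto_sandwich[of "\<lambda>_. 0" L sequentially "\<lambda>n. L 0 * q ^ n"]) auto
  from telescope_sums'[OF this] show ?thesis by (simp add: step) (simp add: L_def)
qed

text \<open>The Taylor series of \<open>sine_moment\<close> at 0, used as its holomorphic extension.\<close>

definition sine_moment_fps :: "complex fps" where
  "sine_moment_fps = Abs_fps (\<lambda>n. of_real (2 ^ n * log_sine_moment n / fact n))"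

text \<open>The coefficients are at most \<open>4 ^ n * M\<close> in norm, so at 1/8 the series is
  dominated by a geometric one of ratio 1/2.\<close>

lemma sine_moment_fps_conv_radius: "fps_conv_radius sine_moment_fps \<ge> ereal (1/8)"
proof -
  define M where "M = integral {0..pi/4} (\<lambda>x. exp (\<bar>ln (2 * sin x)\<bar> / 2))"
  have "summable (\<lambda>n. fps_nth sine_moment_fps n * (1/8) ^ n)"
  proof (rule summable_comparison_test')
    show "summable (\<lambda>n. M * (1/2) ^ n)" by (intro summable_mult summable_geometric) simp
    fix n
    have "norm (fps_nth sine_moment_fps n * (1/8) ^ n) = (1/4) ^ n * \<bar>log_sine_moment n\<bar> / fact n"
      by (simp add: sine_moment_fps_def norm_mult norm_divide norm_power power_mult_distrib[symmetric] power_divide abs_mult)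
        (simp add: power_mult_distrib[symmetric] field_simps)
    also have "\<dots> \<le> (1/4) ^ n * (2 ^ n * fact n * M) / fact n"
      using abs_log_sine_moment_le[of n] unfolding M_def by (intro divide_right_mono mult_left_mono) auto
    also have "\<dots> = M * (1/2) ^ n" by (simp add: power_mult_distrib[symmetric] mult.assoc[symmetric])
    finally show "norm (fps_nth sine_moment_fps n * (1/8) ^ n) \<le> M * (1/2) ^ n" .
  qed
  from conv_radius_geI[OF this] show ?thesis
    by (simp add: fps_conv_radius_def)
qed

lemma sine_moment_fps_conv_radius_pos: "fps_conv_radius sine_moment_fps > 0"
  by (rule less_le_trans[OF _ sine_moment_fps_conv_radius]) simp

subsection \<open>Taylor coefficients\<close>

lemma eval_sine_moment_fps_of_real:
  assumes "0 \<le> a" "a < 1/8"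
  shows "eval_fps sine_moment_fps (of_real a) = of_real (sine_moment a)"
proof -
  have "(\<lambda>n. complex_of_real ((2 * a) ^ n * log_sine_moment n / fact n)) sums of_real (sine_moment a)"
    using assms by (intro sums_of_real sine_moment_sums) auto
  also have "(\<lambda>n. complex_of_real ((2 * a) ^ n * log_sine_moment n / fact n)) =
      (\<lambda>n. fps_nth sine_moment_fps n * of_real a ^ n)"
    by (simp add: sine_moment_fps_def power_mult_distrib mult_ac)
  finally show ?thesis by (simp add: eval_fps_def sums_iff)
qed

lemma higher_deriv_sine_moment_fps:
  "(deriv ^^ n) (eval_fps sine_moment_fps) 0 = of_real (2 ^ n * log_sine_moment n)"
  using fps_nth_conv_deriv[OF sine_moment_fps_conv_radius_pos, of n]
  by (simp add: sine_moment_fps_def field_simps)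

lemma open_Re_gt_neg_half: "open {z. Re z > - 1/2}"
  by (rule open_halfspace_Re_gt)

lemma inverse_central_binomial_holomorphic:
  "inverse_central_binomial holomorphic_on {z. Re z > - 1/2}"
proof -
  have "z + 1 \<notin> \<int>\<^sub>\<le>\<^sub>0" if "Re z > - 1/2" for z
    using that by (intro Re_pos_not_nonpos_Int) auto
  then show ?thesis unfolding inverse_central_binomial_def[abs_def]
    by (intro holomorphic_intros) auto
qed

lemma inverse_central_binomial_of_real:
  "inverse_central_binomial (complex_of_real a) = of_real (inverse_central_binomial a)"
  unfolding inverse_central_binomial_def
  using Gamma_complex_of_real[of "a + 1"] rGamma_complex_of_real[of "2 * a + 1"] by simp

text \<open>Identity theorem: both sides are holomorphic on the disc and agree on the real interval
  (0, 1/8) by the telescoped sum, and this interval accumulates at 0.\<close>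

lemma weighted_beta_series_eq:
  assumes "z \<in> ball 0 (1/8)"
  shows "weighted_beta_series (1 + z) = eval_fps sine_moment_fps z * inverse_central_binomial z"
proof -
  let ?B = "ball 0 (1/8) :: complex set"
  let ?U = "complex_of_real ` {0<..<1/8}"
  have holo: "(\<lambda>z. weighted_beta_series (1 + z) - eval_fps sine_moment_fps z * inverse_central_binomial z)
      holomorphic_on ?B"
  proof (intro holomorphic_on_diff holomorphic_on_mult)
    show "(\<lambda>z. weighted_beta_series (1 + z)) holomorphic_on ?B"
      by (intro holomorphic_on_compose_gen[OF _ weighted_beta_series_holomorphic, unfolded o_def]
          holomorphic_intros) (auto simp: dist_norm)
    have "?B \<subseteq> eball 0 (fps_conv_radius sine_moment_fps)"
      using less_le_trans[OF _ sine_moment_fps_conv_radius] by (auto simp: in_eball_iff)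
    then show "eval_fps sine_moment_fps holomorphic_on ?B"
      by (rule holomorphic_on_eval_fps)
    have "Re z > - 1/2" if "z \<in> ?B" for z
      using that abs_Re_le_cmod[of z] by auto
    then show "inverse_central_binomial holomorphic_on ?B"
      by (intro holomorphic_on_subset[OF inverse_central_binomial_holomorphic]) auto
  qed
  have limpt: "(0::complex) islimpt ?U"
  proof -
    \<comment> \<open>The minimum keeps the witness below both \<open>e\<close> and 1/8.\<close>
    have "\<exists>x\<in>?U. x \<noteq> 0 \<and> dist x 0 < e" if "e > 0" for e
      by (rule bexI[of _ "of_real (min (e/2) (1/16))"]) (use that in auto)
    then show ?thesis unfolding islimpt_approachable by blast
  qed
  have zero: "weighted_beta_series (1 + z) - eval_fps sine_moment_fps z * inverse_central_binomial z = 0"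
    if z: "z \<in> ?U" for z
  proof -
    obtain a where a: "z = of_real a" "0 < a" "a < 1/8" using z by auto
    have "(\<lambda>n. complex_of_real (weighted_beta (a + 1 + real n))) sums
        of_real (sine_moment a * inverse_central_binomial a)"
      using a by (intro sums_of_real weighted_beta_sums_sine_moment)
    also have "(\<lambda>n. complex_of_real (weighted_beta (a + 1 + real n))) =
        (\<lambda>n. weighted_beta (1 + z + of_nat n))"
      by (simp add: a(1) add_ac flip: weighted_beta_of_real)
    finally have "weighted_beta_series (1 + z) = of_real (sine_moment a * inverse_central_binomial a)"
      by (simp add: weighted_beta_series_def sums_iff)
    then show ?thesis
      using a by (simp add: eval_sine_moment_fps_of_real inverse_central_binomial_of_real)
  qed
  have "?U \<subseteq> ?B" by auto
  from analytic_continuation[OF holo open_ball connected_ball this _ limpt zero assms]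
  show ?thesis by simp
qed

lemma higher_deriv_weighted_beta_series:
  "(deriv ^^ r) weighted_beta_series 1 =
    (\<Sum>i=0..r. of_nat (r choose i) * of_real (2 ^ i * log_sine_moment i) *
      (deriv ^^ (r - i)) inverse_central_binomial 0)"
proof -
  have "(deriv ^^ r) weighted_beta_series 1 = (deriv ^^ r) (weighted_beta_series \<circ> (\<lambda>z. 1 + z)) 0"
    by (rule higher_deriv_shift_0)
  also have "\<dots> = (deriv ^^ r) (\<lambda>z. eval_fps sine_moment_fps z * inverse_central_binomial z) 0"
  proof (rule higher_deriv_cong_ev)
    have "eventually (\<lambda>z::complex. z \<in> ball 0 (1/8)) (nhds 0)"
      by (intro eventually_nhds_in_open) auto
    then show "eventually (\<lambda>z. (weighted_beta_series \<circ> (\<lambda>z. 1 + z)) z =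
        eval_fps sine_moment_fps z * inverse_central_binomial z) (nhds 0)"
      by eventually_elim (simp add: weighted_beta_series_eq)
  qed simp
  also have "\<dots> = (\<Sum>i=0..r. of_nat (r choose i) * (deriv ^^ i) (eval_fps sine_moment_fps) 0 *
      (deriv ^^ (r - i)) inverse_central_binomial 0)"
  proof (rule higher_deriv_mult_at)
    show "eval_fps sine_moment_fps analytic_on {0}"
      using sine_moment_fps_conv_radius_pos
      by (intro analytic_on_eval_fps) (auto simp: in_eball_iff zero_ereal_def)
    show "inverse_central_binomial analytic_on {0 :: complex}"
      by (rule holomorphic_on_imp_analytic_at[OF inverse_central_binomial_holomorphic open_Re_gt_neg_half]) simp
  qed
  finally show ?thesis by (simp only: higher_deriv_sine_moment_fps)
qed

section \<open>Derivatives of the inverse central binomial coefficient at 0\<close>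

context
begin

private abbreviation "A \<equiv> {z. Re z > - 1/2}"
text \<open>The \<open>n\<close>-th derivative of the logarithmic derivative of \<open>inverse_central_binomial\<close>.\<close>

private definition logderiv :: "nat \<Rightarrow> complex \<Rightarrow> complex" where
  "logderiv n z = 2 * Polygamma n (z + 1) - 2 ^ Suc n * Polygamma n (2 * z + 1)"

private lemma nonpos_Int:
  assumes "z \<in> A"
  shows "z + 1 \<notin> \<int>\<^sub>\<le>\<^sub>0" "2 * z + 1 \<notin> \<int>\<^sub>\<le>\<^sub>0"
  using assms by (auto intro!: Re_pos_not_nonpos_Int)

private lemma logderiv_deriv:
  assumes "z \<in> A"
  shows "(logderiv n has_field_derivative logderiv (Suc n) z) (at z)"
  unfolding logderiv_def[abs_def] using nonpos_Int[OF assms]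
  by (auto intro!: derivative_eq_intros)

private lemma inverse_central_binomial_deriv:
  assumes "z \<in> A"
  shows "(inverse_central_binomial has_field_derivative inverse_central_binomial z * logderiv 0 z) (at z)"
  unfolding inverse_central_binomial_def[abs_def] logderiv_def using nonpos_Int[OF assms]
  by (auto intro!: derivative_eq_intros simp: power2_eq_square algebra_simps)

text \<open>A formula for the \<open>n\<close>-th derivative valid on all of the open set
  \<open>A\<close> may itself be differentiated there.\<close>

private lemma deriv_eqI:
  assumes "\<And>z. z \<in> A \<Longrightarrow> (deriv ^^ n) f z = g z"
    and "\<And>z. z \<in> A \<Longrightarrow> (g has_field_derivative g' z) (at z)" and "z \<in> A"
  shows "(deriv ^^ Suc n) f z = g' z"
proof -
  have "((deriv ^^ n) f has_field_derivative g' z) (at z)"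
    by (rule has_field_derivative_transform_within_open[OF assms(2)[OF assms(3)] open_Re_gt_neg_half assms(3)])
      (use assms(1) in simp)
  then show ?thesis by (simp add: DERIV_imp_deriv)
qed

text \<open>With \<open>c\<close> the function and \<open>w_n = logderiv n\<close>, repeated
  differentiation of \<open>c' = c * w_0\<close> gives \<open>c'' = c * (w_0^2 + w_1)\<close> and
  \<open>c''' = c * (w_0^3 + 3 * w_0 * w_1 + w_2)\<close>. At 0 the digamma values cancel, so
  \<open>w_0 = 0\<close> and only \<open>w_1\<close> and \<open>w_2\<close> survive.\<close>

lemma higher_deriv_inverse_central_binomial:
  shows "inverse_central_binomial (0 :: complex) = 1"
    and "deriv inverse_central_binomial (0 :: complex) = 0"
    and "(deriv ^^ 2) inverse_central_binomial (0 :: complex) = - (of_real pi ^ 2 / 3)"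
    and "(deriv ^^ 3) inverse_central_binomial (0 :: complex) = of_real (12 * real_zeta 3)"
proof -
  let ?d = "inverse_central_binomial :: complex \<Rightarrow> complex"
  show d0: "?d 0 = 1" by (simp add: inverse_central_binomial_def rGamma_inverse_Gamma)
  have d1: "(deriv ^^ Suc 0) ?d z = ?d z * logderiv 0 z" if "z \<in> A" for z
    by (rule deriv_eqI[OF _ inverse_central_binomial_deriv that]) auto
  have d2: "(deriv ^^ Suc (Suc 0)) ?d z = ?d z * (logderiv 0 z ^ 2 + logderiv 1 z)" if "z \<in> A" for z
    by (rule deriv_eqI[OF d1 _ that])
      (auto intro!: derivative_eq_intros logderiv_deriv inverse_central_binomial_deriv simp: power2_eq_square algebra_simps)
  have d3: "(deriv ^^ Suc (Suc (Suc 0))) ?d z = ?d z * (logderiv 0 z ^ 3 + 3 * logderiv 0 z * logderiv 1 z + logderiv 2 z)"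
    if "z \<in> A" for z
    by (rule deriv_eqI[OF d2 _ that])
      (auto intro!: derivative_eq_intros logderiv_deriv inverse_central_binomial_deriv
        simp: power2_eq_square power3_eq_cube algebra_simps numeral_2_eq_2)
  have "(\<lambda>k. inverse ((1 + of_nat k) ^ Suc 1)) sums ((-1) ^ Suc 1 * Polygamma 1 (1 :: real) / fact 1)"
    by (rule Polygamma_LIMSEQ) auto
  moreover have "(\<lambda>k. inverse ((1 + of_nat k) ^ Suc 1)) sums (pi\<^sup>2 / 6)"
    using inverse_squares_sums by (simp add: field_simps power2_eq_square)
  ultimately have P1: "Polygamma 1 (1 :: real) = pi\<^sup>2 / 6"
    using sums_unique2 by fastforce
  have "(\<lambda>k. inverse ((1 + of_nat k) ^ Suc 2)) sums ((-1) ^ Suc 2 * Polygamma 2 (1 :: real) / fact 2)"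
    by (rule Polygamma_LIMSEQ) auto
  moreover have "inverse ((1 + of_nat k) ^ Suc 2) = 1 / real (k + 1) powr 3" for k
    using powr_realpow[of "1 + real k" 3] by (simp add: inverse_eq_divide add.commute eval_nat_numeral)
  ultimately have P2: "Polygamma 2 (1 :: real) = - 2 * real_zeta 3"
    by (simp add: real_zeta_def sums_iff)
  \<comment> \<open>Both polygamma arguments are 1 at \<open>z = 0\<close>, so the values are
    multiplied by \<open>2 - 2\<close>, \<open>2 - 4\<close> and \<open>2 - 8\<close>.\<close>
  have w: "logderiv 0 0 = 0" "logderiv 1 0 = - (of_real pi ^ 2 / 3)" "logderiv 2 0 = of_real (12 * real_zeta 3)"
    using Polygamma_of_real[of 1 1, where 'a = complex] Polygamma_of_real[of 1 2, where 'a = complex]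
    by (simp_all add: logderiv_def P1[unfolded One_nat_def] P2 mult.commute[of _ 6])
  show "deriv ?d 0 = 0" "(deriv ^^ 2) ?d 0 = - (of_real pi ^ 2 / 3)"
    "(deriv ^^ 3) ?d 0 = of_real (12 * real_zeta 3)"
    using d1[of 0] d2[of 0] d3[of 0] by (simp_all add: d0 w(1) w(2)[unfolded One_nat_def] w(3)[unfolded numeral_2_eq_2]
        numeral_2_eq_2 numeral_3_eq_3)
qed

end

section \<open>Evaluation of the series\<close>

lemma T_term_sums_real:
  assumes "(deriv ^^ r) weighted_beta_series 1 = complex_of_real c"
  shows "T_term r sums c"
  using T_term_sums[of r] unfolding assms sums_of_real_iff .

lemma log_sine_moment_0: "log_sine_moment 0 = pi / 4"
  by (simp add: log_sine_moment_def)

theorem corollary5p3: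
  shows "(\<forall>r\<le>3. summable (T_term r)) \<and>
    T_pi4 0 = pi / 4 \<and>
    T_pi4 1 = - catalan_const \<and>
    T_pi4 2 = - (pi ^ 3 / 12) - 2 * Ls 3 (pi / 2) \<and>
    T_pi4 3 = 3 * pi * real_zeta 3 + pi ^ 2 * catalan_const - 4 * Ls 4 (pi / 2) \<and>
    (\<lambda>n. 2 ^ n * deriv half_central_beta (real (n + 1))) sums
      (- catalan_const - pi / 4 * ln 2)"
proof -
  note d = higher_deriv_inverse_central_binomial
  have S: "log_sine_moment 0 = pi / 4" "log_sine_moment (Suc 0) = - catalan_const / 2"
    using log_sine_moment_0 log_sine_moment_1 by auto
  have T0: "T_term 0 sums (pi / 4)"
    by (rule T_term_sums_real, subst higher_deriv_weighted_beta_series) (simp add: S d)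
  have T1: "T_term 1 sums (- catalan_const)"
    by (rule T_term_sums_real, subst higher_deriv_weighted_beta_series) (simp add: S d)
  \<comment> \<open>The middle Leibniz term drops out with the first derivative at 0. What remains
    is \<open>pi/4 * (- pi^2 / 3)\<close> plus 4 times the second log-sine moment.\<close>
  have T2: "T_term 2 sums (- (pi ^ 3 / 12) - 2 * Ls 3 (pi / 2))"
    by (rule T_term_sums_real, subst higher_deriv_weighted_beta_series)
      (use Ls_pi_half[of 2] d in \<open>simp add: S eval_nat_numeral algebra_simps\<close>)
  \<comment> \<open>The term with the second moment vanishes. The others are
    \<open>pi/4 * 12 * real_zeta 3\<close>, then
    \<open>6 * (- catalan_const / 2) * (- pi^2 / 3)\<close>, and 8 times the third moment.\<close>
  have T3: "T_term 3 sums (3 * pi * real_zeta 3 + pi ^ 2 * catalan_const - 4 * Ls 4 (pi / 2))"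
    by (rule T_term_sums_real, subst higher_deriv_weighted_beta_series)
      (use Ls_pi_half[of 3] d in \<open>simp add: S eval_nat_numeral algebra_simps\<close>)
  \<comment> \<open>Subtracting \<open>ln 2\<close> times the order 0 term from the order 1 term
    isolates the plain derivative.\<close>
  have "(\<lambda>n. T_term 1 n - ln 2 * T_term 0 n) sums (- catalan_const - ln 2 * (pi / 4))"
    by (intro sums_diff sums_mult T0 T1)
  also have "(\<lambda>n. T_term 1 n - ln 2 * T_term 0 n) = (\<lambda>n. 2 ^ n * deriv half_central_beta (real (n + 1)))"
    by (simp add: T_term_def D_plus_log2_pow_def algebra_simps)
  finally have "(\<lambda>n. 2 ^ n * deriv half_central_beta (real (n + 1))) sums
      (- catalan_const - pi / 4 * ln 2)" by (simp add: mult.commute)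
  moreover have "summable (T_term r)" if "r \<le> 3" for r
  proof -
    have "r = 0 \<or> r = 1 \<or> r = 2 \<or> r = 3" using that by auto
    then show ?thesis using T0 T1 T2 T3 by (auto simp: sums_iff)
  qed
  ultimately show ?thesis
    using T0 T1 T2 T3 by (simp add: T_pi4_def sums_iff)
qed

end
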